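(* Let $\alpha,\beta,\delta$ be real numbers such that $0\leq \alpha<1<\beta$ and $0\le\delta<1$, let $g\in\mathcal{S}(\delta,\beta)$, and let $f\in\mathcal{A}$ be given by $f(z)=z+\sum_{n=2}^{\infty}a_nz^n$. If $f\in\mathcal{S}_g(\alpha,\beta)$, then for every integer $n\ge 2$, $$|a_n|\leq \frac{\prod_{k=2}^{n}\left[k-2+\frac{2(\beta-\delta)}{\pi}\sin\frac{\pi(1-\delta)}{\beta-\delta}\right]}{n!}+\frac{2(\beta-\alpha)}{n\pi}\sin\frac{\pi(1-\alpha)}{\beta-\alpha}\left(1+\sum_{j=1}^{n-2}\frac{\prod_{k=2}^{n-j}\left[k-2+\frac{2(\beta-\delta)}{\pi}\sin\frac{\pi(1-\delta)}{\beta-\delta}\right]}{(n-j-1)!}\right).$$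
   Context: $\mathbb{U}=\{z\in\mathbb{C}:|z|<1\}$ is the open unit disk. $\mathcal{A}$ is the class of functions $f(z)=z+\sum_{n=2}^\infty a_nz^n$ analytic in $\mathbb{U}$. For real $\delta<1<\beta$, $\mathcal{S}(\delta,\beta)$ is the class of functions $g\in\mathcal{A}$ satisfying $\delta<\Re\left(\frac{zg'(z)}{g(z)}\right)<\beta$ for all $z\in\mathbb{U}$ (the quotient is taken to have value $1$ at $z=0$). For real $\alpha,\beta,\delta$ with $0\le\alpha<1<\beta$ and $0\le\delta<1$, and for $g\in\mathcal{S}(\delta,\beta)$, $\mathcal{S}_g(\alpha,\beta)$ is the class of functions $f\in\mathcal{A}$ satisfying $\alpha<\Re\left(\frac{zf'(z)}{g(z)}\right)<\beta$ for all $z\in\mathbb{U}$ (the quotient is taken to have value $1$ at $z=0$). Empty sums (e.g. $\sum_{j=1}^{0}$ when $n=2$) are $0$. *)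

theory Defs
  imports "HOL-Complex_Analysis.Complex_Analysis"
begin

text \<open>Functions are total on \<^typ>\<open>complex\<close>; only their values on the open unit disk matter.\<close>

definition class_A :: "(complex \<Rightarrow> complex) set" where
  "class_A = {f. f holomorphic_on ball 0 1 \<and>
     (\<exists>a :: nat \<Rightarrow> complex. \<forall>z \<in> ball 0 1. (\<lambda>n. a (n + 2) * z ^ (n + 2)) sums (f z - z))}"

text \<open>The quotient $z f'(z) / g(z)$ with its singularity at the origin removed: for normalized
  \<open>f\<close> and \<open>g\<close> its value there is 1.\<close>

definition zderiv_quot :: "(complex \<Rightarrow> complex) \<Rightarrow> (complex \<Rightarrow> complex) \<Rightarrow> complex \<Rightarrow> complex" where
  "zderiv_quot f g z = (if z = 0 then 1 else z * deriv f z / g z)"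

text \<open>The nonvanishing clause says that the quotient is defined on the punctured disk, so that
  the convention \<open>x / 0 = 0\<close> plays no role.\<close>

definition class_S :: "real \<Rightarrow> real \<Rightarrow> (complex \<Rightarrow> complex) set" where
  "class_S \<delta> \<beta> = {g \<in> class_A.
     (\<forall>z \<in> ball 0 1 - {0}. g z \<noteq> 0) \<and>
     (\<forall>z \<in> ball 0 1. \<delta> < Re (zderiv_quot g g z) \<and> Re (zderiv_quot g g z) < \<beta>)}"

text \<open>Only meant for \<open>g\<close> in some \<open>class_S \<delta> \<beta>\<close>, hence without zeros in the punctured disk.\<close>

definition class_S_rel ::
  "(complex \<Rightarrow> complex) \<Rightarrow> real \<Rightarrow> real \<Rightarrow> (complex \<Rightarrow> complex) set" where
  "class_S_rel g \<alpha> \<beta> = {f \<in> class_A.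
     \<forall>z \<in> ball 0 1. \<alpha> < Re (zderiv_quot f g z) \<and> Re (zderiv_quot f g z) < \<beta>}"

end

theory Submission
  imports Defs
begin

text \<open>Put \<open>q(z) = z g'(z) / g(z)\<close> and \<open>h(z) = z f'(z) / g(z)\<close>. Both are holomorphic on the disk, take
  the value 1 at the origin, and map into a vertical strip. The theorem follows from one estimate
  for such functions: if \<open>F(0) = 1\<close> and \<open>a < Re F < b\<close>, then every Taylor coefficient of positive
  index has modulus at most \<open>2 (b - a) / \<pi> sin (\<pi> (1 - a) / (b - a))\<close>
  (\<open>norm_coeff_le_of_Re_strip\<close>).

  For the first coefficient this is the Schwarz lemma: the exponential
  \<open>exp (\<i> \<pi> (F - a) / (b - a))\<close> maps into the upper half-plane, and for maps into the half-plane
  the derivative at 0 is at most twice the imaginary part of the value there. The sine is the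
  imaginary part of a point on the unit circle. For the coefficient of index \<open>n\<close>, average \<open>F\<close> over
  rotations by the \<open>n\<close>-th roots of unity. The average still has values in the strip, because the
  strip is convex, and it is a function of \<open>z\<^sup>n\<close> whose first coefficient is the \<open>n\<close>-th
  coefficient of \<open>F\<close>.

  Let \<open>B\<close> and \<open>C\<close> be the bounds obtained for \<open>q\<close> and \<open>h\<close>, and write \<open>b\<^sub>n\<close> for the coefficients of
  \<open>g\<close>. Comparing coefficients in \<open>z g' = q g\<close> gives a recursion that bounds \<open>(n - 1) |b\<^sub>n|\<close> by
  \<open>B (|b\<^sub>1| + \<dots> + |b\<^sub>n\<^sub>-\<^sub>1|)\<close>. The numbers \<open>pochhammer B (n - 1) / fact (n - 1)\<close>, the coefficients of
  \<open>z (1 - z) powr (-B)\<close>, satisfy this recursion with equality, so they dominate \<open>|b\<^sub>n|\<close>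
  (\<open>norm_coeff_le_pochhammer\<close>). Comparing coefficients in \<open>z f' = h g\<close> bounds \<open>n |a\<^sub>n|\<close> by
  \<open>|b\<^sub>n| + C (|b\<^sub>1| + \<dots> + |b\<^sub>n\<^sub>-\<^sub>1|)\<close>, which is the assertion.\<close>

section \<open>Derivative bounds at the centre of the disk\<close>

text \<open>The Schwarz lemma, transported to the half-plane: the Cayley transform
  \<open>(\<zeta> - \<phi> 0) / (\<zeta> - cnj (\<phi> 0))\<close> maps the upper half-plane into the disk and sends \<open>\<phi> 0\<close> to 0, and
  its derivative at \<open>\<phi> 0\<close> has modulus \<open>1 / (2 Im (\<phi> 0))\<close>.\<close>

lemma norm_deriv_0_le_of_Im_pos:
  fixes \<phi> :: "complex \<Rightarrow> complex"
  assumes hol: "\<phi> holomorphic_on ball 0 1"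
    and pos: "\<And>z. z \<in> ball 0 1 \<Longrightarrow> 0 < Im (\<phi> z)"
  shows "norm (deriv \<phi> 0) \<le> 2 * Im (\<phi> 0)"
proof -
  define w where "w z = (\<phi> z - \<phi> 0) / (\<phi> z - cnj (\<phi> 0))" for z
  have pos0: "0 < Im (\<phi> 0)" using pos[of 0] by simp
  have nz: "\<phi> z - cnj (\<phi> 0) \<noteq> 0" if "z \<in> ball 0 1" for z
    using pos[OF that] pos0 by (auto simp: complex_eq_iff)
  have "w holomorphic_on ball 0 1"
    unfolding w_def using nz by (intro holomorphic_intros hol) auto
  moreover have "norm (w z) < 1" if "norm z < 1" for z
  proof -
    have z: "z \<in> ball 0 1" using that by simp
    \<comment> \<open>The squares differ by \<open>4 * Im (\<phi> z) * Im (\<phi> 0)\<close>: a point of the upper half-plane is nearer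
      to \<open>\<phi> 0\<close> than to its mirror image.\<close>
    have "(norm (\<phi> z - \<phi> 0))\<^sup>2 < (norm (\<phi> z - cnj (\<phi> 0)))\<^sup>2"
      unfolding cmod_power2 using mult_pos_pos[OF pos[OF z] pos0]
      by (simp add: power2_eq_square algebra_simps)
    then have "norm (\<phi> z - \<phi> 0) < norm (\<phi> z - cnj (\<phi> 0))"
      by (rule power2_less_imp_less) simp
    then show ?thesis
      unfolding w_def norm_divide using nz[OF z] by (simp add: divide_simps)
  qed
  ultimately have "norm (deriv w 0) \<le> 1"
    by (intro Schwarz_Lemma(2)[of w 0]) (auto simp: w_def)
  moreover have "(w has_field_derivative deriv \<phi> 0 / (\<phi> 0 - cnj (\<phi> 0))) (at 0)"
  proof -
    have "(\<phi> has_field_derivative deriv \<phi> 0) (at 0)"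
      using hol by (rule holomorphic_derivI) auto
    then show ?thesis
      unfolding w_def using nz[of 0]
      by (auto intro!: derivative_eq_intros)
  qed
  then have "deriv w 0 = deriv \<phi> 0 / (\<phi> 0 - cnj (\<phi> 0))"
    by (rule DERIV_imp_deriv)
  moreover have "norm (\<phi> 0 - cnj (\<phi> 0)) = 2 * Im (\<phi> 0)"
    using pos0 by (simp add: complex_diff_cnj norm_mult)
  ultimately show ?thesis
    using pos0 by (simp add: norm_divide divide_simps)
qed

text \<open>Rotating the strip by a right angle and scaling its width to \<open>\<pi>\<close> makes the exponential map it
  onto the upper half-plane. The modulus of \<open>\<phi> 0\<close> occurs as a factor on both sides of the half-plane
  estimate and cancels; so \<open>Im (F 0)\<close> disappears and only a sine is left.\<close>

lemma norm_deriv_0_le_of_Re_strip: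
  fixes F :: "complex \<Rightarrow> complex" and a b :: real
  assumes hol: "F holomorphic_on ball 0 1"
    and strip: "\<And>z. z \<in> ball 0 1 \<Longrightarrow> a < Re (F z) \<and> Re (F z) < b"
  shows "norm (deriv F 0) \<le> 2 * (b - a) / pi * sin (pi * (Re (F 0) - a) / (b - a))"
proof -
  have ab: "a < b" using strip[of 0] by simp
  define c where "c = pi / (b - a)"
  have c: "c > 0" using ab by (simp add: c_def)
  define \<phi> where "\<phi> z = exp (\<i> * of_real c * (F z - of_real a))" for z
  have Im\<phi>: "Im (\<phi> z) = exp (- c * Im (F z)) * sin (c * (Re (F z) - a))" for z
    by (simp add: \<phi>_def Im_exp)
  have hol\<phi>: "\<phi> holomorphic_on ball 0 1"
    unfolding \<phi>_def by (intro holomorphic_intros hol)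
  have "norm (deriv \<phi> 0) \<le> 2 * Im (\<phi> 0)"
  proof (rule norm_deriv_0_le_of_Im_pos[OF hol\<phi>])
    fix z :: complex assume z: "z \<in> ball 0 1"
    have "0 < c * (Re (F z) - a)" using c strip[OF z] by simp
    moreover have "c * (Re (F z) - a) < pi"
      using ab strip[OF z] by (simp add: c_def field_simps)
    ultimately show "0 < Im (\<phi> z)"
      unfolding Im\<phi> by (intro mult_pos_pos[OF exp_gt_zero] sin_gt_zero)
  qed
  moreover have "deriv \<phi> 0 = \<phi> 0 * (\<i> * of_real c * deriv F 0)"
  proof (rule DERIV_imp_deriv)
    have "(F has_field_derivative deriv F 0) (at 0)"
      using hol by (rule holomorphic_derivI) auto
    then show "(\<phi> has_field_derivative \<phi> 0 * (\<i> * of_real c * deriv F 0)) (at 0)"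
      unfolding \<phi>_def by (auto intro!: derivative_eq_intros)
  qed
  moreover have "norm (\<phi> 0) = exp (- c * Im (F 0))"
    by (simp add: \<phi>_def)
  ultimately have "exp (- c * Im (F 0)) * (c * norm (deriv F 0))
      \<le> exp (- c * Im (F 0)) * (2 * sin (c * (Re (F 0) - a)))"
    using c by (simp add: norm_mult Im\<phi> algebra_simps)
  then have "c * norm (deriv F 0) \<le> 2 * sin (c * (Re (F 0) - a))"
    by (simp only: mult_le_cancel_left_pos[OF exp_gt_zero])
  then show ?thesis
    using ab by (simp add: c_def field_simps)
qed

section \<open>Power series with values in a strip\<close>

lemma sum_powers_root_of_unity:
  fixes n m :: nat
  assumes "1 \<le> n"
  defines "\<omega> \<equiv> exp (2 * of_real pi * \<i> / of_nat n :: complex)"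
  shows "(\<Sum>k<n. (\<omega> ^ k) ^ m) = (if n dvd m then of_nat n else 0)"
proof -
  have pow: "\<omega> ^ m = exp (2 * of_real pi * \<i> * of_nat m / of_nat n)"
    unfolding \<omega>_def by (simp add: exp_of_nat_mult[symmetric] mult_ac)
  have eq: "(\<Sum>k<n. (\<omega> ^ k) ^ m) = (\<Sum>k<n. (\<omega> ^ m) ^ k)"
    by (simp add: power_mult[symmetric] mult.commute)
  have "\<omega> ^ m = 1 \<longleftrightarrow> n dvd m"
    unfolding pow by (rule complex_root_unity_eq_1[OF assms(1)])
  moreover have "(\<omega> ^ m) ^ n = 1"
    unfolding pow using assms by (intro complex_root_unity) auto
  ultimately show ?thesis
    unfolding eq by (auto simp: geometric_sum)
qed

text \<open>The mean of \<open>F\<close> over the rotations of \<open>z\<close> by the \<open>n\<close>-th roots of unity keeps exactly the terms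
  whose index is a multiple of \<open>n\<close>. So it has the form \<open>G (z ^ n)\<close>, where \<open>G\<close> is holomorphic on the
  disk and its derivative at 0 is the coefficient \<open>c n\<close>. As a mean of points of the strip it stays in
  the strip, and the bound for the derivative at the centre applies to \<open>G\<close>.\<close>

lemma norm_coeff_le_of_Re_strip:
  fixes F :: "complex \<Rightarrow> complex" and c :: "nat \<Rightarrow> complex" and a b :: real
  assumes sums: "\<And>z. z \<in> ball 0 1 \<Longrightarrow> (\<lambda>n. c n * z ^ n) sums F z"
    and strip: "\<And>z. z \<in> ball 0 1 \<Longrightarrow> a < Re (F z) \<and> Re (F z) < b"
    and n: "1 \<le> n"
  shows "norm (c n) \<le> 2 * (b - a) / pi * sin (pi * (Re (F 0) - a) / (b - a))"
proof -
  define \<omega> where "\<omega> = exp (2 * of_real pi * \<i> / of_nat n :: complex)"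
  have norm\<omega>: "norm (\<omega> ^ k * z) = norm z" for k z
    by (simp add: \<omega>_def norm_mult norm_power)
  define G where "G w = (\<Sum>k. c (n * k) * w ^ k)" for w
  have G: "(\<lambda>k. c (n * k) * (z ^ n) ^ k) sums ((\<Sum>k<n. F (\<omega> ^ k * z)) / of_nat n)"
    if z: "z \<in> ball 0 1" for z
  proof -
    have "(\<lambda>m. (\<Sum>k<n. c m * (\<omega> ^ k * z) ^ m)) sums (\<Sum>k<n. F (\<omega> ^ k * z))"
      using z norm\<omega> by (intro sums_sum sums) simp
    then have "(\<lambda>m. (\<Sum>k<n. c m * (\<omega> ^ k * z) ^ m) / of_nat n)
        sums ((\<Sum>k<n. F (\<omega> ^ k * z)) / of_nat n)"
      by (rule sums_divide)
    also have "(\<lambda>m. (\<Sum>k<n. c m * (\<omega> ^ k * z) ^ m) / of_nat n)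
        = (\<lambda>m. if n dvd m then c m * z ^ m else 0)"
    proof
      fix m
      have "(\<Sum>k<n. c m * (\<omega> ^ k * z) ^ m) = c m * z ^ m * (\<Sum>k<n. (\<omega> ^ k) ^ m)"
        by (simp add: sum_distrib_left power_mult_distrib mult_ac)
      then show "(\<Sum>k<n. c m * (\<omega> ^ k * z) ^ m) / of_nat n
          = (if n dvd m then c m * z ^ m else 0)"
        using n sum_powers_root_of_unity[OF n, of m] by (simp add: \<omega>_def)
    qed
    finally have "(\<lambda>m. if n dvd m then c m * z ^ m else 0)
        sums ((\<Sum>k<n. F (\<omega> ^ k * z)) / of_nat n)" .
    moreover have "strict_mono (\<lambda>k. n * k)"
      using n by (auto intro: strict_monoI)
    ultimately have "(\<lambda>k. if n dvd n * k then c (n * k) * z ^ (n * k) else 0)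
        sums ((\<Sum>k<n. F (\<omega> ^ k * z)) / of_nat n)"
      by (subst sums_mono_reindex[where g = "\<lambda>k. n * k"]) auto
    then show ?thesis
      by (simp add: power_mult)
  qed
  \<comment> \<open>Every point of the disk is an \<open>n\<close>-th power of a point of the disk, so what is known about
    \<open>G (z ^ n)\<close> determines \<open>G\<close> everywhere.\<close>
  have root: "\<exists>z \<in> ball 0 1. w = z ^ n" if "w \<in> ball 0 1" for w :: complex
  proof -
    obtain z where z: "w = z ^ n" using exists_complex_root[of n w] n by auto
    then have "norm z ^ n < 1" using that by (simp add: norm_power)
    then have "norm z < 1" using one_le_power[of "norm z" n] by linarith
    then show ?thesis using z by auto
  qed
  have Gsums: "(\<lambda>k. c (n * k) * w ^ k) sums G w" if "w \<in> ball 0 1" for w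
    using root[OF that] G unfolding G_def by (auto simp: sums_iff)
  have holG: "G holomorphic_on ball 0 1"
    by (rule power_series_holomorphic[where a = "\<lambda>k. c (n * k)"]) (use Gsums in simp)
  have stripG: "a < Re (G w) \<and> Re (G w) < b" if "w \<in> ball 0 1" for w
  proof -
    obtain z where z: "z \<in> ball 0 1" "w = z ^ n" using root[OF \<open>w \<in> ball 0 1\<close>] by auto
    have "G w = (\<Sum>k<n. F (\<omega> ^ k * z)) / of_nat n"
      using G[OF z(1)] Gsums[OF \<open>w \<in> ball 0 1\<close>] z(2) by (simp add: sums_unique2)
    then have ReG: "Re (G w) = (\<Sum>k<n. Re (F (\<omega> ^ k * z))) / real n"
      by simp
    have in_strip: "a < Re (F (\<omega> ^ k * z)) \<and> Re (F (\<omega> ^ k * z)) < b" for k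
      using z(1) norm\<omega> by (intro strip) simp
    have "(\<Sum>k<n. a) < (\<Sum>k<n. Re (F (\<omega> ^ k * z)))"
      using n in_strip by (intro sum_strict_mono) (auto simp: lessThan_empty_iff)
    moreover have "(\<Sum>k<n. Re (F (\<omega> ^ k * z))) < (\<Sum>k<n. b)"
      using n in_strip by (intro sum_strict_mono) (auto simp: lessThan_empty_iff)
    ultimately show ?thesis
      using n unfolding ReG by (simp add: field_simps)
  qed
  have "G has_fps_expansion Abs_fps (\<lambda>k. c (n * k))"
    by (intro has_fps_expansionI eventually_nhds_in_open[of "ball 0 1", THEN eventually_mono])
       (use Gsums in auto)
  from fps_nth_fps_expansion[OF this, of 1] have "deriv G 0 = c n"
    by simp
  moreover have "G 0 = F 0"
    using Gsums[of 0] sums[of 0] by (simp add: sums_iff)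
  ultimately show ?thesis
    using norm_deriv_0_le_of_Re_strip[OF holG stripG] by simp
qed

section \<open>Coefficients of the quotient\<close>

lemma normalized_has_fps_expansion:
  assumes "\<And>z. z \<in> ball 0 1 \<Longrightarrow> (\<lambda>m. a (m + 2) * z ^ (m + 2)) sums (f z - z)"
  shows "f has_fps_expansion Abs_fps (\<lambda>n. if n = 0 then 0 else if n = 1 then 1 else a n)"
    (is "_ has_fps_expansion Abs_fps ?a")
proof (rule has_fps_expansionI)
  have "(\<lambda>n. ?a n * z ^ n) sums f z" if "z \<in> ball 0 1" for z
  proof -
    have "(\<lambda>m. ?a (m + 2) * z ^ (m + 2)) sums (f z - (\<Sum>i<2. ?a i * z ^ i))"
      using assms[OF that] by (simp add: eval_nat_numeral)
    then show ?thesis by (subst (asm) sums_iff_shift) simp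
  qed
  then show "\<forall>\<^sub>F z in nhds 0. (\<lambda>n. fps_nth (Abs_fps ?a) n * z ^ n) sums f z"
    by (intro eventually_nhds_in_open[of "ball 0 1", THEN eventually_mono]) auto
qed

text \<open>Dividing both \<open>z f'(z)\<close> and \<open>g z\<close> by \<open>z\<close> removes the singularity at the origin: \<open>g z / z\<close>
  extends holomorphically and without zeros, and the normalizations of \<open>f\<close> and \<open>g\<close> make the value at
  the origin 1, as the definition of the quotient demands.\<close>

lemma zderiv_quot_holomorphic:
  assumes f: "f holomorphic_on ball 0 1" "deriv f 0 = 1"
    and g: "g holomorphic_on ball 0 1" "g 0 = 0" "deriv g 0 = 1"
    and g_nz: "\<And>z. z \<in> ball 0 1 - {0} \<Longrightarrow> g z \<noteq> 0"
  shows "zderiv_quot f g holomorphic_on ball 0 1"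
proof -
  define k where "k z = (if z = 0 then deriv g 0 else (g z - g 0) / (z - 0))" for z
  have "k holomorphic_on ball 0 1"
    unfolding k_def using g(1) by (rule pole_lemma_open) simp
  moreover have "k z \<noteq> 0" if "z \<in> ball 0 1" for z
    using g_nz[of z] that g(2,3) by (auto simp: k_def)
  ultimately have "(\<lambda>z. deriv f z / k z) holomorphic_on ball 0 1"
    using f(1) by (intro holomorphic_intros) auto
  moreover have "deriv f z / k z = zderiv_quot f g z" if "z \<in> ball 0 1" for z
    using that f(2) g(2,3) by (auto simp: k_def zderiv_quot_def)
  ultimately show ?thesis
    by (rule holomorphic_transform)
qed

text \<open>All that is needed of the analytic hypotheses, as a statement about formal power series. It serves
  twice: with \<open>f\<close> replaced by \<open>g\<close> it yields the recursion for the coefficients of \<open>g\<close>, and with \<open>f\<close>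
  itself it expresses the coefficients of \<open>f\<close> by those of \<open>g\<close>.\<close>

lemma strip_quotient_coeffs:
  fixes f g :: "complex \<Rightarrow> complex" and A B :: "complex fps" and \<alpha> \<beta> :: real
  assumes f: "f holomorphic_on ball 0 1" "f has_fps_expansion A" "fps_nth A 1 = 1"
    and g: "g holomorphic_on ball 0 1" "g has_fps_expansion B"
      "fps_nth B 0 = 0" "fps_nth B 1 = 1"
    and g_nz: "\<And>z. z \<in> ball 0 1 - {0} \<Longrightarrow> g z \<noteq> 0"
    and strip: "\<And>z. z \<in> ball 0 1 \<Longrightarrow>
      \<alpha> < Re (zderiv_quot f g z) \<and> Re (zderiv_quot f g z) < \<beta>"
  obtains H where "fps_nth H 0 = 1"
    and "\<And>n. 1 \<le> n \<Longrightarrow>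
      norm (fps_nth H n) \<le> 2 * (\<beta> - \<alpha>) / pi * sin (pi * (1 - \<alpha>) / (\<beta> - \<alpha>))"
    and "fps_X * fps_deriv A = H * B"
proof -
  define h where "h = zderiv_quot f g"
  define H where "H = fps_expansion h 0"
  have h0: "h 0 = 1" by (simp add: h_def zderiv_quot_def)
  have f1: "deriv f 0 = 1" using fps_nth_fps_expansion[OF f(2), of 1] f(3) by simp
  have g0: "g 0 = 0" using fps_nth_fps_expansion[OF g(2), of 0] g(3) by simp
  have g1: "deriv g 0 = 1" using fps_nth_fps_expansion[OF g(2), of 1] g(4) by simp
  have hol: "h holomorphic_on ball 0 1"
    unfolding h_def by (rule zderiv_quot_holomorphic[OF f(1) f1 g(1) g0 g1 g_nz])
  have H: "h has_fps_expansion H"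
    unfolding H_def using hol by (intro has_fps_expansion_fps_expansion[of "ball 0 1"]) auto
  show thesis
  proof
    show "fps_nth H 0 = 1"
      using fps_nth_fps_expansion[OF H, of 0] h0 by simp
  next
    fix n :: nat assume n: "1 \<le> n"
    have sums: "(\<lambda>n. fps_nth H n * z ^ n) sums h z" if "z \<in> ball 0 1" for z
      using that hol by (intro has_fps_expansion_imp_sums_complex[OF H, of 1]) (auto simp: one_ereal_def)
    have "norm (fps_nth H n) \<le> 2 * (\<beta> - \<alpha>) / pi * sin (pi * (Re (h 0) - \<alpha>) / (\<beta> - \<alpha>))"
      by (rule norm_coeff_le_of_Re_strip[OF sums _ n]) (use strip in \<open>auto simp: h_def\<close>)
    then show "norm (fps_nth H n) \<le> 2 * (\<beta> - \<alpha>) / pi * sin (pi * (1 - \<alpha>) / (\<beta> - \<alpha>))"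
      by (simp add: h0)
  next
    have "\<forall>\<^sub>F z in nhds 0. z * deriv f z = h z * g z"
      by (intro eventually_nhds_in_open[of "ball 0 1", THEN eventually_mono])
         (use g0 g_nz in \<open>auto simp: h_def zderiv_quot_def\<close>)
    moreover have "(\<lambda>z. z * deriv f z) has_fps_expansion fps_X * fps_deriv A"
      by (intro fps_expansion_intros f(2))
    ultimately have "(\<lambda>z. h z * g z) has_fps_expansion fps_X * fps_deriv A"
      by (rule has_fps_expansion_cong[THEN iffD1, OF _ refl])
    moreover have "(\<lambda>z. h z * g z) has_fps_expansion H * B"
      by (intro fps_expansion_intros H g(2))
    ultimately show "fps_X * fps_deriv A = H * B"
      by (rule fps_expansion_unique_complex)
  qed
qed

lemma fps_nth_X_deriv: "fps_nth (fps_X * fps_deriv A) n = of_nat n * fps_nth A n"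
  for A :: "complex fps"
  by (cases n) auto

section \<open>The recursion for the coefficients\<close>

lemma pochhammer_conv_prod_2:
  "1 \<le> n \<Longrightarrow> (\<Prod>k = 2..n. real k - 2 + B) = pochhammer B (n - 1)"
proof (induction n rule: dec_induct)
  case (step n)
  then obtain m where "n = Suc m" by (cases n) auto
  with step show ?case by (simp add: pochhammer_Suc add.commute)
qed simp

text \<open>The numbers \<open>pochhammer B m / fact m\<close> solve the extremal recursion exactly: they are the
  coefficients of \<open>(1 - z) powr (-B)\<close>, and this is the differential equation
  \<open>z y' = (B z / (1 - z)) y\<close> read off coefficientwise.\<close>

lemma sum_pochhammer_div_fact:
  fixes B :: real
  shows "B * (\<Sum>i<m. pochhammer B i / fact i) = real m * (pochhammer B m / fact m)"
proof (induction m)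
  case (Suc m)
  have "real (Suc m) * (pochhammer B (Suc m) / fact (Suc m)) = (B + real m) * (pochhammer B m / fact m)"
    by (simp add: pochhammer_Suc divide_simps)
  with Suc show ?case by (simp only: sum.lessThan_Suc distrib_left distrib_right)
qed simp

text \<open>Replacing every \<open>norm (q i)\<close> by its bound \<open>B\<close> turns the recursion into the extremal one, whose
  solution is known; strong induction compares the two. The index is shifted by one against that of
  \<open>b\<close>, so that the recursion starts at \<open>m = 0\<close>.\<close>

lemma norm_coeff_le_pochhammer:
  fixes b q :: "nat \<Rightarrow> complex" and B :: real
  assumes b1: "b (Suc 0) = 1"
    and q: "\<And>i. 1 \<le> i \<Longrightarrow> norm (q i) \<le> B"
    and rec: "\<And>m. of_nat m * b (Suc m) = (\<Sum>i<m. q (m - i) * b (Suc i))"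
  shows "norm (b (Suc m)) \<le> pochhammer B m / fact m"
proof (induction m rule: less_induct)
  case (less m)
  have B: "0 \<le> B" using norm_ge_zero q[of 1] by (meson le_refl order_trans)
  show ?case
  proof (cases "m = 0")
    case True
    then show ?thesis using b1 by simp
  next
    case False
    have "real m * norm (b (Suc m)) = norm (\<Sum>i<m. q (m - i) * b (Suc i))"
      by (simp flip: rec add: norm_mult)
    also have "\<dots> \<le> (\<Sum>i<m. B * (pochhammer B i / fact i))"
      by (intro sum_norm_le) (auto simp: norm_mult simp del: times_divide_eq_right intro!: mult_mono q less B)
    also have "\<dots> = real m * (pochhammer B m / fact m)"
      by (simp only: sum_distrib_left[symmetric] sum_pochhammer_div_fact)
    finally show ?thesis using False by (simp only: mult_le_cancel_left_pos of_nat_0_less_iff neq0_conv)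
  qed
qed

theorem theorem2:
  fixes \<alpha> \<beta> \<delta> :: real and f g :: "complex \<Rightarrow> complex" and a :: "nat \<Rightarrow> complex" and n :: nat
  assumes "0 \<le> \<alpha>" "\<alpha> < 1" "1 < \<beta>" "0 \<le> \<delta>" "\<delta> < 1"
    and "g \<in> class_S \<delta> \<beta>"
    and "f \<in> class_A"
    and "\<And>z. z \<in> ball 0 1 \<Longrightarrow> (\<lambda>m. a (m + 2) * z ^ (m + 2)) sums (f z - z)"
    and "f \<in> class_S_rel g \<alpha> \<beta>"
    and "2 \<le> n"
  shows "norm (a n) \<le>
      (\<Prod>k = 2..n. real k - 2 + 2 * (\<beta> - \<delta>) / pi * sin (pi * (1 - \<delta>) / (\<beta> - \<delta>))) / fact n
    + 2 * (\<beta> - \<alpha>) / (real n * pi) * sin (pi * (1 - \<alpha>) / (\<beta> - \<alpha>)) *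
      (1 + (\<Sum>j = 1..n - 2.
         (\<Prod>k = 2..n - j. real k - 2 + 2 * (\<beta> - \<delta>) / pi * sin (pi * (1 - \<delta>) / (\<beta> - \<delta>)))
           / fact (n - j - 1)))"
proof -
  define B where "B = 2 * (\<beta> - \<delta>) / pi * sin (pi * (1 - \<delta>) / (\<beta> - \<delta>))"
  define C where "C = 2 * (\<beta> - \<alpha>) / pi * sin (pi * (1 - \<alpha>) / (\<beta> - \<alpha>))"
  define P where "P m = pochhammer B m / fact m" for m
  \<comment> \<open>A series of class \<open>A\<close> carries no information about the entries with index 0 and 1 of its
    coefficient sequence; \<open>b\<close> and \<open>c\<close> set them to the true values 0 and 1.\<close>
  obtain a' where "\<And>z. z \<in> ball 0 1 \<Longrightarrow> (\<lambda>n. a' (n + 2) * z ^ (n + 2)) sums (g z - z)"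
    using assms(6) unfolding class_S_def class_A_def by blast
  note G = normalized_has_fps_expansion[OF this]
  define b where "b n = (if n = 0 then 0 else if n = 1 then 1 else a' n)" for n
  have G: "g has_fps_expansion Abs_fps b" using G unfolding b_def .
  define c where "c n = (if n = 0 then 0 else if n = 1 then 1 else a n)" for n
  have F: "f has_fps_expansion Abs_fps c"
    using normalized_has_fps_expansion[OF assms(8)] unfolding c_def .
  have holf: "f holomorphic_on ball 0 1" and holg: "g holomorphic_on ball 0 1"
    using assms(6,7) by (auto simp: class_S_def class_A_def)
  have g_nz: "\<And>z. z \<in> ball 0 1 - {0} \<Longrightarrow> g z \<noteq> 0"
    using assms(6) by (auto simp: class_S_def)

  obtain Q where Q: "fps_nth Q 0 = 1" "\<And>n. 1 \<le> n \<Longrightarrow> norm (fps_nth Q n) \<le> B"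
      "fps_X * fps_deriv (Abs_fps b) = Q * Abs_fps b"
    by (rule strip_quotient_coeffs[OF holg G _ holg G _ _ g_nz, of \<delta> \<beta>])
       (use assms(6) in \<open>auto simp: b_def B_def class_S_def\<close>)
  obtain H where H: "fps_nth H 0 = 1" "\<And>n. 1 \<le> n \<Longrightarrow> norm (fps_nth H n) \<le> C"
      "fps_X * fps_deriv (Abs_fps c) = H * Abs_fps b"
    by (rule strip_quotient_coeffs[OF holf F _ holg G _ _ g_nz, of \<alpha> \<beta>])
       (use assms(9) in \<open>auto simp: b_def c_def C_def class_S_rel_def\<close>)

  \<comment> \<open>The constant term of \<open>g\<close> vanishes, so the Cauchy product starts at \<open>b 1\<close>; the term with
    \<open>b (Suc m)\<close> is split off because it cancels against the left side when \<open>K = Q\<close>.\<close>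
  have conv: "fps_nth (K * Abs_fps b) (Suc m) =
      fps_nth K 0 * b (Suc m) + (\<Sum>i<m. fps_nth K (m - i) * b (Suc i))" for K m
  proof -
    have "fps_nth (K * Abs_fps b) (Suc m) = (\<Sum>i\<le>Suc m. b i * fps_nth K (Suc m - i))"
      by (subst mult.commute) (simp add: fps_mult_nth atLeast0AtMost)
    also have "\<dots> = (\<Sum>i\<le>m. b (Suc i) * fps_nth K (m - i))"
      by (subst sum.atMost_Suc_shift) (simp add: b_def)
    finally show ?thesis
      by (simp add: lessThan_Suc_atMost[symmetric] mult.commute)
  qed
  have b: "norm (b (Suc m)) \<le> P m" for m
    unfolding P_def
  proof (rule norm_coeff_le_pochhammer[where q = "fps_nth Q"])
    show "of_nat m * b (Suc m) = (\<Sum>i<m. fps_nth Q (m - i) * b (Suc i))" for m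
      using fps_nth_X_deriv[of "Abs_fps b" "Suc m"] unfolding Q(3) conv Q(1)
      by (simp add: algebra_simps)
  qed (use Q(2) in \<open>auto simp: b_def\<close>)

  \<comment> \<open>The term of the convolution with \<open>b 1 = 1\<close> is the 1 in the final bracket, and reversing the
    summation order gives the index \<open>n - j\<close>.\<close>
  obtain m where n: "n = Suc (Suc m)" using assms(10) by (metis add_2_eq_Suc le_Suc_ex)
  have C: "0 \<le> C" using norm_ge_zero H(2)[of 1] by (meson le_refl order_trans)
  have "of_nat n * a n = b n + (\<Sum>i<Suc m. fps_nth H (Suc m - i) * b (Suc i))"
    using fps_nth_X_deriv[of "Abs_fps c" n] conv[of H "Suc m"] unfolding H(3) H(1)
    by (simp add: n c_def)
  then have "real n * norm (a n) = norm (b n + (\<Sum>i<Suc m. fps_nth H (Suc m - i) * b (Suc i)))"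
    by (metis norm_mult norm_of_nat)
  also have "\<dots> \<le> P (Suc m) + (\<Sum>i<Suc m. C * P i)"
    by (intro norm_triangle_mono sum_norm_le)
       (auto simp: n norm_mult intro!: mult_mono b H(2) C)
  also have "(\<Sum>i<Suc m. C * P i) = C * (1 + (\<Sum>i<m. P (Suc i)))"
    by (subst sum.lessThan_Suc_shift) (simp add: P_def sum_distrib_left distrib_left)
  also have "(\<Sum>i<m. P (Suc i)) = (\<Sum>j = 1..m. P (Suc m - j))"
    by (rule sum.reindex_bij_witness[of _ "\<lambda>j. m - j" "\<lambda>i. m - i"])
       (auto simp: Suc_diff_le)
  finally have "norm (a n) \<le> (P (Suc m) + C * (1 + (\<Sum>j = 1..m. P (Suc m - j)))) / real n"
    by (simp add: n field_simps)
  also have "\<dots> = P (Suc m) / real n + C / real n * (1 + (\<Sum>j = 1..m. P (Suc m - j)))"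
    by (simp add: add_divide_distrib)
  also have "P (Suc m) / real n = (\<Prod>k = 2..n. real k - 2 + B) / fact n"
    using assms(10) pochhammer_conv_prod_2[of n B]
    by (simp add: P_def n fact_Suc[of "Suc m"] del: fact_Suc prod.cl_ivl_Suc)
  also have "(\<Sum>j = 1..m. P (Suc m - j)) =
      (\<Sum>j = 1..n - 2. (\<Prod>k = 2..n - j. real k - 2 + B) / fact (n - j - 1))"
    by (rule sum.cong) (auto simp: P_def n pochhammer_conv_prod_2)
  also have "C / real n = 2 * (\<beta> - \<alpha>) / (real n * pi) * sin (pi * (1 - \<alpha>) / (\<beta> - \<alpha>))"
    by (simp add: C_def mult.commute)
  finally show ?thesis unfolding B_def .
qed

end
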